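(* Let $\{c_n\}_{n=1}^\infty$ be a sequence of complex numbers with $\lim_{n\to\infty}c_n=0$ and $\sum_{n=1}^\infty |c_n|=\infty$. If $\{c_n\}_{n=1}^\infty$ has two different ratios, then $R(\{c_n\})=\mathbb{C}$.
   Context: For a complex sequence $\{c_n\}_{n=1}^\infty$, $R(\{c_n\})=\{\sum_{n=1}^\infty \pm c_n\}$ denotes the set of all sums $\sum_{n=1}^\infty x_n c_n$ over those sign sequences $\{x_n\}\in\{-1,1\}^{\mathbb{N}}$ for which the series converges in $\mathbb{C}$ (in the given order). Write $c_n=a_n+ib_n$ with $a_n,b_n\in\mathbb{R}$. Let $\{c_n\}\notin\ell^1$ with $c_n\to 0$. An element $t\in\mathbb{R}\cup\{\infty\}$ is called a ratio of $\{c_n\}$ if there is a subsequence $\{c_{n_k}\}_{k=1}^\infty\notin\ell^1$ (i.e. $\sum_k|c_{n_k}|=\infty$) of nonzero terms such that $a_{n_k}/b_{n_k}\to t$ as $k\to\infty$. Here $\infty$ is a single unsigned infinity: $a_{n_k}/b_{n_k}\to\infty$ means $|a_{n_k}/b_{n_k}|\to\infty$, with the quotient understood as $\infty$ when $b_{n_k}=0$, $a_{n_k}\ne 0$ (equivalently $b_{n_k}/a_{n_k}\to 0$). *)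

theory Defs
  imports "HOL-Analysis.Analysis"
begin

text \<open>
  Sequences are indexed from 0 instead of 1. The order of summation is the order of the indices;
  sign sequences whose series diverges contribute nothing.
\<close>

definition signed_sums :: "(nat \<Rightarrow> complex) \<Rightarrow> complex set" where
  "signed_sums c = {s. \<exists>x :: nat \<Rightarrow> complex. (\<forall>n. x n \<in> {-1, 1}) \<and> (\<lambda>n. x n * c n) sums s}"

text \<open>
  The set of real numbers together with a single unsigned infinity is the type \<^typ>\<open>real option\<close>,
  \<^const>\<open>None\<close> being infinity, with the topology of the one-point compactification of the real line.
  The quotient has to be set to infinity explicitly for a vanishing imaginary part, because
  division by zero yields zero. Its value at 0 is irrelevant: ratios only use nonzero terms.
\<close>

definition re_im_quotient :: "complex \<Rightarrow> real option" where
  "re_im_quotient z = (if Im z = 0 then None else Some (Re z / Im z))"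

definition is_ratio :: "(nat \<Rightarrow> complex) \<Rightarrow> real option \<Rightarrow> bool" where
  "is_ratio c t \<longleftrightarrow>
    (\<exists>r :: nat \<Rightarrow> nat. strict_mono r \<and> (\<forall>k. c (r k) \<noteq> 0) \<and>
       \<not> summable (\<lambda>k. norm (c (r k))) \<and>
       limitin (Alexandroff_compactification euclidean) (\<lambda>k. re_im_quotient (c (r k))) t sequentially)"

text \<open>Convergence of the quotients in elementary terms.\<close>

lemma limitin_re_im_quotient_Some:
  "limitin (Alexandroff_compactification euclidean) (\<lambda>k. re_im_quotient (z k)) (Some t) F \<longleftrightarrow>
     (\<forall>\<^sub>F k in F. Im (z k) \<noteq> 0) \<and> ((\<lambda>k. Re (z k) / Im (z k)) \<longlongrightarrow> t) F"
    (is "?L \<longleftrightarrow> ?R")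
proof
  assume L: ?L
  have *: "\<forall>\<^sub>F k in F. Im (z k) \<noteq> 0 \<and> Re (z k) / Im (z k) \<in> U" if "open U" "t \<in> U" for U
  proof -
    have "openin (Alexandroff_compactification euclidean) (Some ` U)"
      using that by (auto simp: openin_Alexandroff_compactification)
    then have "\<forall>\<^sub>F k in F. re_im_quotient (z k) \<in> Some ` U"
      using L that unfolding limitin_def by blast
    then show ?thesis
      by (rule eventually_mono) (auto simp: re_im_quotient_def split: if_splits)
  qed
  show ?R
  proof (intro conjI topological_tendstoI)
    show "\<forall>\<^sub>F k in F. Im (z k) \<noteq> 0"
      using *[of UNIV] by simp
    show "\<forall>\<^sub>F k in F. Re (z k) / Im (z k) \<in> U" if "open U" "t \<in> U" for U
      using *[OF that] by (rule eventually_mono) simp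
  qed
next
  assume R: ?R
  have "\<forall>\<^sub>F k in F. re_im_quotient (z k) \<in> W"
    if "openin (Alexandroff_compactification euclidean) W" "Some t \<in> W" for W
  proof -
    have "\<exists>U. open U \<and> Some ` U \<subseteq> W \<and> t \<in> U"
      using that(1) unfolding openin_Alexandroff_compactification
    proof (elim disjE exE conjE)
      fix U assume "openin euclidean U" "W = Some ` U"
      then show ?thesis
        using that(2) by (intro exI[of _ U]) auto
    next
      fix C assume "closedin euclidean C" "W = insert None (Some ` (topspace euclidean - C))"
      then show ?thesis
        using that(2) by (intro exI[of _ "- C"]) auto
    qed
    then obtain U where U: "open U" "t \<in> U" "Some ` U \<subseteq> W"
      by blast
    then have "\<forall>\<^sub>F k in F. Re (z k) / Im (z k) \<in> U"
      using R by (auto simp: tendsto_def)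
    with R have "\<forall>\<^sub>F k in F. Im (z k) \<noteq> 0 \<and> Re (z k) / Im (z k) \<in> U"
      by (auto intro: eventually_conj)
    then show ?thesis
      by (rule eventually_mono) (use U in \<open>auto simp: re_im_quotient_def\<close>)
  qed
  then show ?L
    by (simp add: limitin_def)
qed

lemma limitin_re_im_quotient_None:
  "limitin (Alexandroff_compactification euclidean) (\<lambda>k. re_im_quotient (z k)) None F \<longleftrightarrow>
     (\<forall>M. \<forall>\<^sub>F k in F. Im (z k) = 0 \<or> \<bar>Re (z k) / Im (z k)\<bar> > M)"
    (is "?L \<longleftrightarrow> ?R")
proof
  assume L: ?L
  show ?R
  proof
    fix M :: real
    have "openin (Alexandroff_compactification euclidean) (insert None (Some ` (UNIV - {-M..M})))"
      by (auto simp: openin_Alexandroff_compactification)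
    then have "\<forall>\<^sub>F k in F. re_im_quotient (z k) \<in> insert None (Some ` (UNIV - {-M..M}))"
      using L unfolding limitin_def by blast
    then show "\<forall>\<^sub>F k in F. Im (z k) = 0 \<or> \<bar>Re (z k) / Im (z k)\<bar> > M"
      by (rule eventually_mono) (auto simp: re_im_quotient_def simp del: abs_divide split: if_splits)
  qed
next
  assume R: ?R
  have "\<forall>\<^sub>F k in F. re_im_quotient (z k) \<in> W"
    if "openin (Alexandroff_compactification euclidean) W" "None \<in> W" for W
  proof -
    have "\<exists>C. compact C \<and> W = insert None (Some ` (UNIV - C))"
      using that by (auto simp: openin_Alexandroff_compactification)
    then obtain C where C: "compact C" "W = insert None (Some ` (UNIV - C))"
      by blast
    obtain M where M: "\<And>x. x \<in> C \<Longrightarrow> \<bar>x\<bar> \<le> M"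
      using compact_imp_bounded[OF C(1)] by (auto simp: bounded_iff)
    have "\<forall>\<^sub>F k in F. Im (z k) = 0 \<or> \<bar>Re (z k) / Im (z k)\<bar> > M"
      using R by blast
    then show ?thesis
      proof (rule eventually_mono)
      fix k assume k: "Im (z k) = 0 \<or> \<bar>Re (z k) / Im (z k)\<bar> > M"
      show "re_im_quotient (z k) \<in> W"
        using k M[of "Re (z k) / Im (z k)"] by (auto simp: re_im_quotient_def C(2) simp del: abs_divide)
    qed
  qed
  then show ?L
    by (simp add: limitin_def)
qed

end

theory Submission
  imports Defs
begin

text \<open>
  Attach to a ratio \<open>t\<close> the real linear form that vanishes on the line of that direction:
  \<open>Re z - t Im z\<close>, or \<open>Im z\<close> if the ratio is infinite. Let \<open>f\<close> and \<open>g\<close> be the forms of two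
  different ratios. They are coordinates of the plane, so it suffices to choose the signs such that
  \<open>f\<close> and \<open>g\<close> of the partial sums \<open>S n\<close> tend to \<open>f z\<close> and \<open>g z\<close>, where \<open>z\<close> is
  the target.

  Near the first direction \<open>f\<close> is small compared with the norm, and the terms near this direction
  have infinite total norm. Choosing finitely many of them at a time, with a tolerance that is
  halved from one block of indices to the next, gives an index set \<open>A\<close> along which \<open>f\<close> is
  absolutely summable while \<open>g\<close> is not (\<open>thin_along_ratio\<close>). The second ratio gives a set
  \<open>B\<close> with the roles of \<open>f\<close> and \<open>g\<close> exchanged. Thus \<open>A\<close> steers \<open>g\<close> and disturbs
  \<open>f\<close> only summably, and \<open>B\<close> steers \<open>f\<close> and disturbs \<open>g\<close> only summably.

  The terms outside \<open>A\<close> and \<open>B\<close> get signs that make their own series converge, which is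
  possible for every null sequence in the plane (\<open>signs_summable\<close>, the two-dimensional case of the
  Dvoretzky-Hanani theorem). Then the signs on \<open>A\<close> and \<open>B\<close> are chosen greedily: at an index
  in \<open>A\<close> against the current error \<open>g (S n - z)\<close>, at an index in \<open>B\<close> against
  \<open>f (S n - z)\<close>. Each of the two errors now moves by steps against its own sign, with infinite
  total length and tending to 0, and by a convergent perturbation, hence it tends to 0
  (\<open>steering_tendsto_zero\<close>).
\<close>

section \<open>Series cut into blocks\<close>

lemma ex_block:
  fixes N :: "nat \<Rightarrow> nat"
  assumes "strict_mono N" "N 0 = 0"
  shows "\<exists>k. N k \<le> n \<and> n < N (Suc k)"
proof (induction n)
  case 0
  have "N 0 < N (Suc 0)"
    using assms(1) by (simp add: strict_mono_less)
  then show ?case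
    using assms(2) by (intro exI[of _ 0]) auto
next
  case (Suc n)
  then obtain k where k: "N k \<le> n" "n < N (Suc k)"
    by blast
  have "N (Suc k) < N (Suc (Suc k))"
    using assms(1) by (simp add: strict_mono_less)
  then show ?case
    using k by (cases "Suc n = N (Suc k)") (auto intro: exI[of _ k] exI[of _ "Suc k"])
qed

text \<open>
  The function is meant for strictly increasing \<open>N\<close> with \<open>N 0 = 0\<close>; then the block is unique.
\<close>

definition block_index :: "(nat \<Rightarrow> nat) \<Rightarrow> nat \<Rightarrow> nat" where
  "block_index N n = (SOME k. N k \<le> n \<and> n < N (Suc k))"

lemma block_index:
  assumes "strict_mono N" "N 0 = 0"
  shows "N (block_index N n) \<le> n" "n < N (Suc (block_index N n))"
  using someI_ex[OF ex_block[OF assms, of n]] unfolding block_index_def by auto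

lemma block_index_eq:
  assumes "strict_mono N" "N 0 = 0" "N k \<le> n" "n < N (Suc k)"
  shows "block_index N n = k"
proof -
  have "N k < N (Suc (block_index N n))" "N (block_index N n) < N (Suc k)"
    using block_index[OF assms(1,2), of n] assms(3,4) by linarith+
  then show ?thesis
    using assms(1) by (auto simp: strict_mono_less)
qed

lemma block_index_at_top:
  assumes "strict_mono N" "N 0 = 0"
  shows "filterlim (block_index N) at_top sequentially"
  unfolding filterlim_at_top eventually_sequentially
proof (intro allI exI impI)
  fix k n assume "N k \<le> n"
  then have "N k < N (Suc (block_index N n))"
    using block_index[OF assms, of n] by linarith
  then show "k \<le> block_index N n"
    using assms(1) by (auto simp: strict_mono_less)
qed

text \<open>
  The sums over complete blocks converge absolutely, and the incomplete block at the end of a partial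
  sum is bounded by a null sequence. Both the choice of convergent signs and the thinning of a
  sequence are done block by block and use this criterion.
\<close>

lemma summable_if_blocks_summable:
  fixes d :: "nat \<Rightarrow> 'a::banach"
  assumes N: "strict_mono N" "N 0 = 0"
    and e: "summable e"
    and bound: "\<And>k n. N k \<le> n \<Longrightarrow> n \<le> N (Suc k) \<Longrightarrow> norm (\<Sum>i=N k..<n. d i) \<le> e k"
  shows "summable d"
proof -
  define b where "b k = (\<Sum>i=N k..<N (Suc k). d i)" for k
  have mono: "N k \<le> N (Suc k)" for k
    using N(1) by (simp add: strict_mono_less_eq)
  have "summable b"
    using e by (rule summable_comparison_test') (auto simp: b_def intro: bound mono)
  then have b: "(\<lambda>k. \<Sum>j<k. b j) \<longlonglongrightarrow> suminf b"
    by (rule summable_LIMSEQ)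
  have S: "(\<Sum>j<k. b j) = (\<Sum>i<N k. d i)" for k
  proof (induction k)
    case (Suc k)
    then show ?case
      using sum.atLeastLessThan_concat[of 0 "N k" "N (Suc k)" d] mono[of k]
      by (simp add: b_def lessThan_atLeast0)
  qed (simp add: N)
  let ?k = "block_index N"
  note top = block_index_at_top[OF N]
  have "(\<lambda>n. (\<Sum>i<N (?k n). d i)) \<longlonglongrightarrow> suminf b"
    using filterlim_compose[OF b top] unfolding S .
  moreover have "(\<lambda>n. (\<Sum>i=N (?k n)..<n. d i)) \<longlonglongrightarrow> 0"
  proof (rule Lim_null_comparison)
    show "\<forall>\<^sub>F n in sequentially. norm (\<Sum>i=N (?k n)..<n. d i) \<le> e (?k n)"
      using block_index[OF N] by (intro always_eventually allI bound) (auto simp: less_imp_le)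
    show "(\<lambda>n. e (?k n)) \<longlonglongrightarrow> 0"
      using filterlim_compose[OF summable_LIMSEQ_zero[OF e] top] .
  qed
  ultimately have "(\<lambda>n. (\<Sum>i<N (?k n). d i) + (\<Sum>i=N (?k n)..<n. d i)) \<longlonglongrightarrow> suminf b + 0"
    by (rule tendsto_add)
  moreover have "(\<Sum>i<N (?k n). d i) + (\<Sum>i=N (?k n)..<n. d i) = (\<Sum>i<n. d i)" for n
    using sum.atLeastLessThan_concat[of 0 "N (?k n)" n d] block_index(1)[OF N, of n]
    by (simp add: lessThan_atLeast0)
  ultimately show ?thesis
    by (auto simp: summable_def sums_def)
qed

section \<open>Convergent signed series in the plane\<close>

lemma three_complex_dependent:
  fixes p q r :: complex
  obtains a b d :: real where "a *\<^sub>R p + b *\<^sub>R q + d *\<^sub>R r = 0" "a \<noteq> 0 \<or> b \<noteq> 0 \<or> d \<noteq> 0"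
proof (cases "Re p * Im q = Im p * Re q")
  case False
  \<comment> \<open>Cramer's rule: the coefficients are the cross products of the other two vectors.\<close>
  show ?thesis
    by (rule that[of "Re q * Im r - Im q * Re r" "Re r * Im p - Im r * Re p" "Re p * Im q - Im p * Re q"])
      (use False in \<open>auto simp: complex_eq_iff algebra_simps\<close>)
next
  case True
  show ?thesis
  proof (cases "p = 0")
    case True
    then show ?thesis
      by (intro that[of 1 0 0]) auto
  next
    case pnz: False
    show ?thesis
    proof (cases "Re p = 0")
      case 1: True
      then show ?thesis
        using pnz True by (intro that[of "Im q" "- Im p" 0]) (auto simp: complex_eq_iff)
    next
      case False
      then show ?thesis
        using True by (intro that[of "Re q" "- Re p" 0]) (auto simp: complex_eq_iff algebra_simps)
    qed
  qed
qed

text \<open>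
  Moving the coefficients along a linear dependency keeps the combination unchanged, and the largest
  absolute value starts at most at 1 and becomes arbitrarily large, so it is equal to 1 at some time.
\<close>

lemma round_one_of_three:
  fixes p q r :: complex
  assumes "\<bar>\<alpha>\<bar> \<le> 1" "\<bar>\<beta>\<bar> \<le> 1"
  obtains \<alpha>' \<beta>' \<gamma>' :: real
  where "\<alpha>' *\<^sub>R p + \<beta>' *\<^sub>R q + \<gamma>' *\<^sub>R r = \<alpha> *\<^sub>R p + \<beta> *\<^sub>R q"
    "\<bar>\<alpha>'\<bar> \<le> 1" "\<bar>\<beta>'\<bar> \<le> 1" "\<bar>\<gamma>'\<bar> \<le> 1"
    "\<bar>\<alpha>'\<bar> = 1 \<or> \<bar>\<beta>'\<bar> = 1 \<or> \<bar>\<gamma>'\<bar> = 1"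
proof -
  obtain a b d where dep: "a *\<^sub>R p + b *\<^sub>R q + d *\<^sub>R r = 0" and nz: "a \<noteq> 0 \<or> b \<noteq> 0 \<or> d \<noteq> 0"
    by (rule three_complex_dependent)
  define m where "m t = max \<bar>\<alpha> + t * a\<bar> (max \<bar>\<beta> + t * b\<bar> \<bar>t * d\<bar>)" for t
  have unit: "\<exists>t\<ge>0. \<bar>x + t * y\<bar> \<ge> 1" if "y \<noteq> 0" for x y :: real
  proof (intro exI conjI)
    have "\<bar>(1 + \<bar>x\<bar>) / \<bar>y\<bar> * y\<bar> = 1 + \<bar>x\<bar>"
      using that by (simp add: abs_mult)
    then show "\<bar>x + (1 + \<bar>x\<bar>) / \<bar>y\<bar> * y\<bar> \<ge> 1"
      by linarith
  qed simp
  have "\<exists>t\<ge>0. m t \<ge> 1"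
    using nz unit[of a \<alpha>] unit[of b \<beta>] unit[of d 0] by (auto simp: m_def le_max_iff_disj)
  then obtain T where T: "T \<ge> 0" "m T \<ge> 1"
    by blast
  have "continuous_on {0..T} m"
    unfolding m_def by (intro continuous_intros)
  moreover have "m 0 \<le> 1"
    using assms by (simp add: m_def)
  ultimately obtain t where "m t = 1"
    using IVT'[of m 0 1 T] T by blast
  then have t: "\<bar>\<alpha> + t * a\<bar> \<le> 1" "\<bar>\<beta> + t * b\<bar> \<le> 1" "\<bar>t * d\<bar> \<le> 1"
    "\<bar>\<alpha> + t * a\<bar> = 1 \<or> \<bar>\<beta> + t * b\<bar> = 1 \<or> \<bar>t * d\<bar> = 1"
    unfolding m_def by linarith+
  have "(\<alpha> + t * a) *\<^sub>R p + (\<beta> + t * b) *\<^sub>R q + (t * d) *\<^sub>R r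
      = \<alpha> *\<^sub>R p + \<beta> *\<^sub>R q + t *\<^sub>R (a *\<^sub>R p + b *\<^sub>R q + d *\<^sub>R r)"
    by (simp add: algebra_simps)
  with dep t show ?thesis
    by (intro that[of "\<alpha> + t * a" "\<beta> + t * b" "t * d"]) auto
qed

lemma norm_pending_le:
  fixes p q :: "'a::real_normed_vector"
  assumes "\<bar>\<sigma>\<bar> = 1" "\<bar>\<tau>\<bar> = 1" "\<bar>\<alpha>\<bar> \<le> 1" "\<bar>\<beta>\<bar> \<le> 1" "norm p \<le> D" "norm q \<le> D"
  shows "norm ((\<sigma> - \<alpha>) *\<^sub>R p + (\<tau> - \<beta>) *\<^sub>R q) \<le> 4 * D"
proof -
  have "norm ((\<sigma> - \<alpha>) *\<^sub>R p) \<le> 2 * D" "norm ((\<tau> - \<beta>) *\<^sub>R q) \<le> 2 * D"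
    unfolding norm_scaleR using assms by (auto intro!: mult_mono)
  then show ?thesis
    using norm_triangle_ineq[of "(\<sigma> - \<alpha>) *\<^sub>R p" "(\<tau> - \<beta>) *\<^sub>R q"] by linarith
qed

text \<open>
  Read \<open>p\<close> and \<open>q\<close> as earlier terms whose signs are still undecided and which currently carry
  the fractional coefficients \<open>\<alpha>\<close> and \<open>\<beta>\<close>. The partial sums are measured against
  \<open>\<alpha> p + \<beta> q\<close>. Each new term enters with coefficient 0, and rounding one of the three
  coefficients to a sign leaves two undecided terms and the same fractional sum; so at all times the
  signed sum differs from the fractional one by the error of two roundings only, whatever the number
  of terms.
\<close>

lemma signs_with_two_pending:
  fixes p q :: complex and c :: "nat \<Rightarrow> complex"
  assumes "\<And>i. i < n \<Longrightarrow> norm (c i) \<le> D" "norm p \<le> D" "norm q \<le> D" "\<bar>\<alpha>\<bar> \<le> 1" "\<bar>\<beta>\<bar> \<le> 1"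
  shows "\<exists>\<sigma> \<tau> s. \<bar>\<sigma>\<bar> = 1 \<and> \<bar>\<tau>\<bar> = 1 \<and> (\<forall>i. \<bar>s i\<bar> = (1::real)) \<and>
    (\<forall>k\<le>n. norm ((\<sigma> - \<alpha>) *\<^sub>R p + (\<tau> - \<beta>) *\<^sub>R q + (\<Sum>i<k. s i *\<^sub>R c i)) \<le> 4 * D)"
  using assms
proof (induction n arbitrary: c p q \<alpha> \<beta>)
  case 0
  then show ?case
    using norm_pending_le[of 1 1 \<alpha> \<beta> p D q] by (intro exI[of _ 1] exI[of _ "\<lambda>_. 1"]) simp
next
  case (Suc n)
  let ?r = "c 0" and ?c = "\<lambda>i. c (Suc i)"
  have r: "norm ?r \<le> D" and c: "\<And>i. i < n \<Longrightarrow> norm (?c i) \<le> D"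
    using Suc.prems(1) by auto
  obtain \<alpha>' \<beta>' \<gamma>' where eq: "\<alpha>' *\<^sub>R p + \<beta>' *\<^sub>R q + \<gamma>' *\<^sub>R ?r = \<alpha> *\<^sub>R p + \<beta> *\<^sub>R q"
    and le: "\<bar>\<alpha>'\<bar> \<le> 1" "\<bar>\<beta>'\<bar> \<le> 1" "\<bar>\<gamma>'\<bar> \<le> 1"
    and one: "\<bar>\<alpha>'\<bar> = 1 \<or> \<bar>\<beta>'\<bar> = 1 \<or> \<bar>\<gamma>'\<bar> = 1"
    using round_one_of_three[OF Suc.prems(4,5)] by metis
  \<comment> \<open>Whichever coefficient was rounded, its term is decided, and the other two terms become the
    pending ones of the induction hypothesis.\<close>
  have "\<exists>\<sigma> \<tau> \<rho> s. \<bar>\<sigma>\<bar> = 1 \<and> \<bar>\<tau>\<bar> = 1 \<and> \<bar>\<rho>\<bar> = 1 \<and> (\<forall>i. \<bar>s i\<bar> = (1::real)) \<and>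
    (\<forall>k\<le>n. norm ((\<sigma> - \<alpha>') *\<^sub>R p + (\<tau> - \<beta>') *\<^sub>R q + (\<rho> - \<gamma>') *\<^sub>R ?r + (\<Sum>i<k. s i *\<^sub>R ?c i)) \<le> 4 * D)"
    using one
  proof (elim disjE)
    assume 1: "\<bar>\<alpha>'\<bar> = 1"
    obtain \<sigma> \<tau> s where "\<bar>\<sigma>\<bar> = 1" "\<bar>\<tau>\<bar> = 1" "\<forall>i. \<bar>s i\<bar> = (1::real)"
      "\<forall>k\<le>n. norm ((\<sigma> - \<gamma>') *\<^sub>R ?r + (\<tau> - \<beta>') *\<^sub>R q + (\<Sum>i<k. s i *\<^sub>R ?c i)) \<le> 4 * D"
      using Suc.IH[of ?c ?r q \<gamma>' \<beta>'] c r Suc.prems le by blast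
    then show ?thesis
      using 1 by (intro exI[of _ \<alpha>'] exI[of _ \<tau>] exI[of _ \<sigma>] exI[of _ s]) (simp add: algebra_simps)
  next
    assume 1: "\<bar>\<beta>'\<bar> = 1"
    obtain \<sigma> \<tau> s where "\<bar>\<sigma>\<bar> = 1" "\<bar>\<tau>\<bar> = 1" "\<forall>i. \<bar>s i\<bar> = (1::real)"
      "\<forall>k\<le>n. norm ((\<sigma> - \<alpha>') *\<^sub>R p + (\<tau> - \<gamma>') *\<^sub>R ?r + (\<Sum>i<k. s i *\<^sub>R ?c i)) \<le> 4 * D"
      using Suc.IH[of ?c p ?r \<alpha>' \<gamma>'] c r Suc.prems le by blast
    then show ?thesis
      using 1 by (intro exI[of _ \<sigma>] exI[of _ \<beta>'] exI[of _ \<tau>] exI[of _ s]) (simp add: algebra_simps)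
  next
    assume 1: "\<bar>\<gamma>'\<bar> = 1"
    obtain \<sigma> \<tau> s where "\<bar>\<sigma>\<bar> = 1" "\<bar>\<tau>\<bar> = 1" "\<forall>i. \<bar>s i\<bar> = (1::real)"
      "\<forall>k\<le>n. norm ((\<sigma> - \<alpha>') *\<^sub>R p + (\<tau> - \<beta>') *\<^sub>R q + (\<Sum>i<k. s i *\<^sub>R ?c i)) \<le> 4 * D"
      using Suc.IH[of ?c p q \<alpha>' \<beta>'] c r Suc.prems le by blast
    then show ?thesis
      using 1 by (intro exI[of _ \<sigma>] exI[of _ \<tau>] exI[of _ \<gamma>'] exI[of _ s]) (simp add: algebra_simps)
  qed
  then obtain \<sigma> \<tau> \<rho> s where *: "\<bar>\<sigma>\<bar> = 1" "\<bar>\<tau>\<bar> = 1" "\<bar>\<rho>\<bar> = 1" "\<forall>i. \<bar>s i\<bar> = (1::real)"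
    and bd: "\<And>k. k \<le> n \<Longrightarrow> norm ((\<sigma> - \<alpha>') *\<^sub>R p + (\<tau> - \<beta>') *\<^sub>R q + (\<rho> - \<gamma>') *\<^sub>R ?r
      + (\<Sum>i<k. s i *\<^sub>R ?c i)) \<le> 4 * D"
    by blast
  let ?s = "case_nat \<rho> s"
  have "norm ((\<sigma> - \<alpha>) *\<^sub>R p + (\<tau> - \<beta>) *\<^sub>R q + (\<Sum>i<k. ?s i *\<^sub>R c i)) \<le> 4 * D"
    if "k \<le> Suc n" for k
  proof (cases k)
    case 0
    then show ?thesis
      using norm_pending_le[OF *(1,2) Suc.prems(4,5,2,3)] by simp
  next
    case (Suc k')
    have "(\<Sum>i<k. ?s i *\<^sub>R c i) = \<rho> *\<^sub>R ?r + (\<Sum>i<k'. s i *\<^sub>R ?c i)"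
      unfolding Suc sum.lessThan_Suc_shift by simp
    then have "(\<sigma> - \<alpha>) *\<^sub>R p + (\<tau> - \<beta>) *\<^sub>R q + (\<Sum>i<k. ?s i *\<^sub>R c i)
        = (\<sigma> - \<alpha>') *\<^sub>R p + (\<tau> - \<beta>') *\<^sub>R q + (\<rho> - \<gamma>') *\<^sub>R ?r + (\<Sum>i<k'. s i *\<^sub>R ?c i)"
      using eq by (simp add: algebra_simps)
    then show ?thesis
      using bd[of k'] that Suc by simp
  qed
  moreover have "\<forall>i. \<bar>?s i\<bar> = 1"
    using * by (simp split: nat.split)
  ultimately show ?case
    using *(1,2) by blast
qed

lemma signs_bounded_partial_sums:
  fixes c :: "nat \<Rightarrow> complex"
  assumes "\<And>i. m \<le> i \<Longrightarrow> i < n \<Longrightarrow> norm (c i) \<le> D" "D \<ge> 0"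
  shows "\<exists>s. (\<forall>i. \<bar>s i\<bar> = (1::real)) \<and> (\<forall>k. m \<le> k \<longrightarrow> k \<le> n \<longrightarrow> norm (\<Sum>i=m..<k. s i *\<^sub>R c i) \<le> 4 * D)"
proof -
  obtain s where s: "\<forall>i. \<bar>s i\<bar> = (1::real)"
    "\<forall>k\<le>n - m. norm (\<Sum>i<k. s i *\<^sub>R c (i + m)) \<le> 4 * D"
    using signs_with_two_pending[of "n - m" "\<lambda>i. c (i + m)" D 0 0 0 0] assms by auto
  have "norm (\<Sum>i=m..<k. s (i - m) *\<^sub>R c i) \<le> 4 * D" if "m \<le> k" "k \<le> n" for k
  proof -
    have "(\<Sum>i=m..<k. s (i - m) *\<^sub>R c i) = (\<Sum>i<k - m. s i *\<^sub>R c (i + m))"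
      using sum.shift_bounds_nat_ivl[of "\<lambda>i. s (i - m) *\<^sub>R c i" 0 m "k - m"] that
      by (simp add: lessThan_atLeast0)
    then show ?thesis
      using s(2) that by simp
  qed
  then show ?thesis
    using s(1) by (intro exI[of _ "\<lambda>i. s (i - m)"]) auto
qed

text \<open>
  On a block of indices where the terms are bounded by \<open>D\<close> signs can keep all partial sums within
  \<open>4 * D\<close>. For a null sequence the blocks can be arranged such that these bounds decrease
  geometrically.
\<close>

lemma signs_summable:
  fixes c :: "nat \<Rightarrow> complex"
  assumes "c \<longlonglongrightarrow> 0"
  obtains s :: "nat \<Rightarrow> real" where "\<And>i. \<bar>s i\<bar> = 1" "summable (\<lambda>i. s i *\<^sub>R c i)"
proof -
  obtain B where B: "B > 0" "\<And>i. norm (c i) \<le> B"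
    using convergent_imp_Bseq[OF convergentI[OF assms]] by (auto simp: Bseq_def)
  \<comment> \<open>Scaling the bounds by \<open>B\<close> allows the first block to begin at 0.\<close>
  have "\<exists>N. \<forall>k. ((k = 0 \<longrightarrow> N k = 0) \<and> (\<forall>i\<ge>N k. norm (c i) \<le> B * (1/2) ^ k)) \<and> N k < N (Suc k)"
  proof (rule dependent_nat_choice)
    show "\<exists>x. (0 = (0::nat) \<longrightarrow> x = 0) \<and> (\<forall>i\<ge>x. norm (c i) \<le> B * (1/2) ^ 0)"
      using B by auto
  next
    fix x k :: nat
    have "B * (1/2) ^ Suc k > 0"
      using B by simp
    then obtain M where "\<forall>i\<ge>M. norm (c i) < B * (1/2) ^ Suc k"
      using assms unfolding LIMSEQ_iff by (metis diff_zero)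
    then show "\<exists>y. ((Suc k = 0 \<longrightarrow> y = 0) \<and> (\<forall>i\<ge>y. norm (c i) \<le> B * (1/2) ^ Suc k)) \<and> x < y"
      by (intro exI[of _ "max M (Suc x)"]) (auto intro: less_imp_le)
  qed
  then obtain N where N: "N 0 = 0" "strict_mono N"
    and small: "\<And>k i. N k \<le> i \<Longrightarrow> norm (c i) \<le> B * (1/2) ^ k"
    by (metis strict_mono_Suc_iff)
  have "\<exists>s. (\<forall>i. \<bar>s i\<bar> = (1::real)) \<and> (\<forall>n. N k \<le> n \<longrightarrow> n \<le> N (Suc k) \<longrightarrow>
      norm (\<Sum>i=N k..<n. s i *\<^sub>R c i) \<le> 4 * (B * (1/2) ^ k))" for k
    using B by (intro signs_bounded_partial_sums small) auto
  then obtain s where s: "\<And>k i. \<bar>s k i\<bar> = (1::real)"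
    and bd: "\<And>k n. N k \<le> n \<Longrightarrow> n \<le> N (Suc k) \<Longrightarrow>
      norm (\<Sum>i=N k..<n. s k i *\<^sub>R c i) \<le> 4 * (B * (1/2) ^ k)"
    by metis
  show ?thesis
  proof (rule that[of "\<lambda>i. s (block_index N i) i"])
    show "summable (\<lambda>i. s (block_index N i) i *\<^sub>R c i)"
    proof (rule summable_if_blocks_summable[OF N(2,1)])
      show "summable (\<lambda>k. 4 * (B * (1/2::real) ^ k))"
        by (intro summable_mult summable_geometric) simp
      fix k n assume k: "N k \<le> n" "n \<le> N (Suc k)"
      then have "(\<Sum>i=N k..<n. s (block_index N i) i *\<^sub>R c i) = (\<Sum>i=N k..<n. s k i *\<^sub>R c i)"
        by (intro sum.cong refl) (simp add: block_index_eq[OF N(2,1), of k])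
      then show "norm (\<Sum>i=N k..<n. s (block_index N i) i *\<^sub>R c i) \<le> 4 * (B * (1/2) ^ k)"
        using bd[OF k] by simp
    qed
  qed (simp add: s)
qed

section \<open>Thinning\<close>

text \<open>
  The upper bound is what the shortest block of sum at least 1 satisfies. It is needed because a block
  of uncontrolled sum could outweigh the tolerance that was fixed before the block was chosen.
\<close>

lemma nonsummable_block:
  fixes w :: "nat \<Rightarrow> real"
  assumes w: "\<And>n. 0 \<le> w n" "\<And>n. w n \<le> W" and "\<not> summable w"
  obtains n where "m < n" "1 \<le> sum w {m..<n}" "sum w {m..<n} \<le> 1 + W"
proof -
  have "\<exists>n. 1 \<le> sum w {m..<n}"
  proof (rule ccontr)
    assume "\<nexists>n. 1 \<le> sum w {m..<n}"
    then have lt: "sum w {m..<n} \<le> 1" for n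
      by (meson linorder_not_le less_imp_le)
    have "(\<Sum>i<n. w (i + m)) \<le> 1" for n
      using lt[of "n + m"] sum.shift_bounds_nat_ivl[of w 0 m n] by (simp add: lessThan_atLeast0)
    then have "summable (\<lambda>i. w (i + m))"
      using w(1) by (intro bounded_imp_summable[of _ 1]) (auto simp: lessThan_Suc_atMost[symmetric] simp del: sum.lessThan_Suc)
    then show False
      using assms(3) by (simp add: summable_iff_shift)
  qed
  then obtain n where n: "1 \<le> sum w {m..<n}" and least: "\<And>j. j < n \<Longrightarrow> sum w {m..<j} < 1"
    using exists_least_iff[of "\<lambda>n. 1 \<le> sum w {m..<n}"] by (auto simp: not_le)
  have "m < n"
    using n by (rule_tac ccontr) simp
  then obtain j where j: "n = Suc j" "m \<le> j"
    by (cases n) auto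
  then show ?thesis
    using that[of n] n \<open>m < n\<close> least[of j] w(2)[of j] by simp
qed

text \<open>
  In block \<open>k\<close> keep the indices with \<open>h \<le> \<delta> k * w\<close>, where \<open>\<delta> k\<close> decreases
  geometrically, and end the block as soon as the kept weights reach 1. Every block then contributes at
  least 1 to the sum of \<open>w\<close>, but at most \<open>\<delta> k * (1 + W)\<close> to the sum of \<open>h\<close>.
\<close>

lemma thin_to_summable:
  fixes h w :: "nat \<Rightarrow> real"
  assumes h: "\<And>n. 0 \<le> h n" and w: "\<And>n. 0 \<le> w n" "\<And>n. w n \<le> W"
    and ns: "\<And>\<epsilon>. \<epsilon> > 0 \<Longrightarrow> \<not> summable (\<lambda>n. if h n \<le> \<epsilon> * w n then w n else 0)"
    and "\<epsilon> > 0"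
  obtains A where "\<And>n. n \<in> A \<Longrightarrow> h n \<le> \<epsilon> * w n"
    "summable (\<lambda>n. if n \<in> A then h n else 0)" "\<not> summable (\<lambda>n. if n \<in> A then w n else 0)"
proof -
  define \<delta> where "\<delta> k = \<epsilon> * (1/2) ^ k" for k :: nat
  define v where "v k n = (if h n \<le> \<delta> k * w n then w n else 0)" for k n
  have \<delta>: "0 < \<delta> k" "\<delta> k \<le> \<epsilon>" for k
    using \<open>\<epsilon> > 0\<close> by (auto simp: \<delta>_def power_le_one)
  have W: "0 \<le> W"
    using w[of 0] by linarith
  have v: "0 \<le> v k n" "v k n \<le> W" for k n
    using w W by (auto simp: v_def)
  have "\<exists>N. \<forall>k. (k = 0 \<longrightarrow> N k = 0) \<and> (N k < N (Suc k) \<and>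
      1 \<le> sum (v k) {N k..<N (Suc k)} \<and> sum (v k) {N k..<N (Suc k)} \<le> 1 + W)"
  proof (rule dependent_nat_choice)
    fix x k :: nat
    have "\<not> summable (v k)"
      unfolding v_def using ns \<delta> by blast
    then show "\<exists>y. (Suc k = 0 \<longrightarrow> y = 0) \<and> (x < y \<and> 1 \<le> sum (v k) {x..<y} \<and> sum (v k) {x..<y} \<le> 1 + W)"
      using nonsummable_block[of "v k" W x] v by (metis nat.distinct(1))
  qed auto
  then obtain N where N: "N 0 = 0" "strict_mono N"
    and large: "\<And>k. 1 \<le> sum (v k) {N k..<N (Suc k)}"
    and le: "\<And>k. sum (v k) {N k..<N (Suc k)} \<le> 1 + W"
    by (metis strict_mono_Suc_iff)
  define A where "A = {n. h n \<le> \<delta> (block_index N n) * w n}"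
  have A_iff: "n \<in> A \<longleftrightarrow> h n \<le> \<delta> k * w n" if "N k \<le> n" "n < N (Suc k)" for k n
    using block_index_eq[OF N(2,1) that] by (simp add: A_def)
  show ?thesis
  proof (rule that[of A])
    fix n assume "n \<in> A"
    then show "h n \<le> \<epsilon> * w n"
      using \<delta>(2) w(1) mult_right_mono[of "\<delta> (block_index N n)" \<epsilon> "w n"] by (auto simp: A_def)
  next
    show "summable (\<lambda>n. if n \<in> A then h n else 0)"
    proof (rule summable_if_blocks_summable[OF N(2,1)])
      show "summable (\<lambda>k. \<delta> k * (1 + W))"
        unfolding \<delta>_def by (intro summable_mult summable_mult2 summable_geometric) simp
      fix k n assume k: "N k \<le> n" "n \<le> N (Suc k)"
      have "(\<Sum>i=N k..<n. if i \<in> A then h i else 0) \<le> (\<Sum>i=N k..<n. \<delta> k * v k i)"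
        using k by (intro sum_mono) (auto simp: A_iff v_def)
      also have "\<dots> \<le> (\<Sum>i=N k..<N (Suc k). \<delta> k * v k i)"
        using k v(1) \<delta>(1) by (intro sum_mono2) (auto simp: less_imp_le)
      also have "\<dots> \<le> \<delta> k * (1 + W)"
        using le \<delta>(1) by (simp add: sum_distrib_left[symmetric])
      finally show "norm (\<Sum>i=N k..<n. if i \<in> A then h i else 0) \<le> \<delta> k * (1 + W)"
        using h by (simp add: sum_nonneg)
    qed
  next
    show "\<not> summable (\<lambda>n. if n \<in> A then w n else 0)"
    proof
      assume "summable (\<lambda>n. if n \<in> A then w n else 0)"
      then obtain M where M: "\<And>m n. m \<ge> M \<Longrightarrow> norm (\<Sum>i=m..<n. if i \<in> A then w i else 0) < 1"
        unfolding summable_Cauchy by (meson zero_less_one)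
      have "(\<Sum>i=N M..<N (Suc M). if i \<in> A then w i else 0) = sum (v M) {N M..<N (Suc M)}"
        by (intro sum.cong refl) (auto simp: A_iff v_def)
      then show False
        using M[of "N M" "N (Suc M)"] large[of M] strict_mono_imp_increasing[OF N(2)] by fastforce
    qed
  qed
qed

section \<open>Steering\<close>

text \<open>
  Adding the tail of the perturbation series to \<open>u\<close> gives a sequence \<open>v\<close> that changes by the
  steps \<open>e\<close> alone and differs from \<open>u\<close> by a null sequence. Where \<open>v\<close> exceeds the late tails
  in absolute value it has the sign of \<open>u\<close>, so the step is directed towards 0. As the total
  length of the steps is infinite, \<open>v\<close> must come close to 0; as single steps are short, it
  stays there.
\<close>

lemma steering_tendsto_zero:
  fixes u p e :: "nat \<Rightarrow> real"
  assumes step: "\<And>n. u (Suc n) = u n + p n + e n"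
    and opposed: "\<And>n. e n * u n \<le> 0"
    and p: "summable p" and e: "e \<longlonglongrightarrow> 0" and ns: "\<not> summable (\<lambda>n. \<bar>e n\<bar>)"
  shows "u \<longlonglongrightarrow> 0"
proof -
  define r where "r n = suminf p - (\<Sum>i<n. p i)" for n
  define v where "v n = u n + r n" for n
  have v_step: "v (Suc n) = v n + e n" for n
    by (simp add: v_def r_def step)
  have "r \<longlonglongrightarrow> suminf p - suminf p"
    unfolding r_def by (intro tendsto_intros summable_LIMSEQ p)
  then have r: "r \<longlonglongrightarrow> 0"
    by simp
  have "\<exists>M. \<forall>n\<ge>M. \<bar>u n\<bar> < \<epsilon>" if "\<epsilon> > 0" for \<epsilon>
  proof -
    define \<delta> where "\<delta> = \<epsilon> / 4"
    have \<delta>: "\<delta> > 0"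
      using that by (simp add: \<delta>_def)
    have "\<forall>\<^sub>F n in sequentially. \<bar>r n\<bar> < \<delta> \<and> \<bar>e n\<bar> < \<delta>"
      using tendstoD[OF r \<delta>] tendstoD[OF e \<delta>] by (auto simp: eventually_conj_iff)
    then obtain N where N: "\<And>n. n \<ge> N \<Longrightarrow> \<bar>r n\<bar> < \<delta>" "\<And>n. n \<ge> N \<Longrightarrow> \<bar>e n\<bar> < \<delta>"
      by (auto simp: eventually_sequentially)
    have descend: "\<bar>v (Suc n)\<bar> = \<bar>v n\<bar> - \<bar>e n\<bar>" if "n \<ge> N" "\<bar>v n\<bar> > \<delta>" for n
    proof -
      have "v n > \<delta> \<and> u n > 0 \<or> v n < - \<delta> \<and> u n < 0"
        using that(2) N(1)[OF that(1)] by (auto simp: v_def)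
      then have "v n > \<delta> \<and> e n \<le> 0 \<or> v n < - \<delta> \<and> e n \<ge> 0"
        using opposed[of n] by (auto simp: mult_le_0_iff)
      then show ?thesis
        using N(2)[OF that(1)] by (auto simp: v_step)
    qed
    have "\<exists>m\<ge>N. \<bar>v m\<bar> \<le> 2 * \<delta>"
    proof (rule ccontr)
      assume "\<not> ?thesis"
      then have big: "\<bar>v n\<bar> > \<delta>" if "n \<ge> N" for n
        using that \<delta> by force
      have sum: "(\<Sum>i<n. \<bar>e (i + N)\<bar>) = \<bar>v N\<bar> - \<bar>v (n + N)\<bar>" for n
        by (induction n) (auto simp: descend big)
      have "summable (\<lambda>i. \<bar>e (i + N)\<bar>)"
      proof (rule bounded_imp_summable)
        show "(\<Sum>i\<le>n. \<bar>e (i + N)\<bar>) \<le> \<bar>v N\<bar>" for n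
          using sum[of "Suc n"] by (simp add: lessThan_Suc_atMost)
      qed simp
      then show False
        using ns summable_iff_shift[of "\<lambda>n. \<bar>e n\<bar>" N] by simp
    qed
    then obtain m where m: "m \<ge> N" "\<bar>v m\<bar> \<le> 2 * \<delta>"
      by blast
    have bounded: "\<bar>v n\<bar> \<le> 2 * \<delta>" if "n \<ge> m" for n
      using that
    proof (induction n rule: dec_induct)
      case (step n)
      then have n: "n \<ge> N"
        using m by simp
      show ?case
      proof (cases "\<bar>v n\<bar> > \<delta>")
        case True
        then show ?thesis
          using descend[OF n] step.IH by simp
      next
        case False
        then show ?thesis
          using N(2)[OF n] by (simp add: v_step)
      qed
    qed (simp add: m)
    have "\<bar>u n\<bar> < \<epsilon>" if "n \<ge> m" for n
    proof -
      have "\<bar>u n + r n\<bar> \<le> 2 * \<delta>" "\<bar>r n\<bar> < \<delta>"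
        using bounded[OF that] N(1)[of n] m(1) that by (auto simp: v_def)
      then show ?thesis
        using \<delta> by (simp add: \<delta>_def abs_if split: if_splits)
    qed
    then show ?thesis
      by blast
  qed
  then show ?thesis
    by (simp add: LIMSEQ_iff)
qed

text \<open>
  The greedy choices for the two coordinates depend on each other through the common partial sum.
  This is harmless: what one choice does to the other coordinate is absolutely summable for every
  choice of signs.
\<close>

lemma signed_sum_by_steering:
  fixes c :: "nat \<Rightarrow> complex" and f g :: "complex \<Rightarrow> real"
  assumes c: "c \<longlonglongrightarrow> 0"
    and f: "bounded_linear f" and g: "bounded_linear g"
    and K: "\<And>z. norm z \<le> K * (\<bar>f z\<bar> + \<bar>g z\<bar>)"
    and disj: "A \<inter> B = {}"
    and A: "summable (\<lambda>n. if n \<in> A then \<bar>f (c n)\<bar> else 0)"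
      "\<not> summable (\<lambda>n. if n \<in> A then \<bar>g (c n)\<bar> else 0)"
    and B: "summable (\<lambda>n. if n \<in> B then \<bar>g (c n)\<bar> else 0)"
      "\<not> summable (\<lambda>n. if n \<in> B then \<bar>f (c n)\<bar> else 0)"
  shows "z \<in> signed_sums c"
proof -
  interpret f: bounded_linear f by (fact f)
  interpret g: bounded_linear g by (fact g)
  define d where "d n = (if n \<in> A \<union> B then 0 else c n)" for n
  have "d \<longlonglongrightarrow> 0"
    using c by (rule Lim_null_comparison[rotated, OF tendsto_norm_zero]) (simp add: d_def)
  then obtain s where s: "\<And>n. \<bar>s n\<bar> = 1" and sd: "summable (\<lambda>n. s n *\<^sub>R d n)"
    using signs_summable by metis
  define opp where "opp a b = (if a * b \<le> 0 then 1 else - 1 :: real)" for a b :: real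
  have opp: "\<bar>opp a b\<bar> = 1" "opp a b * a * b \<le> 0" for a b
    by (auto simp: opp_def)
  define \<sigma> where "\<sigma> n S = (if n \<in> A then opp (g (c n)) (g (S - z))
      else if n \<in> B then opp (f (c n)) (f (S - z)) else s n)" for n S
  define S where "S = rec_nat 0 (\<lambda>n S. S + \<sigma> n S *\<^sub>R c n)"
  have S: "S 0 = 0" "S (Suc n) = S n + \<sigma> n (S n) *\<^sub>R c n" for n
    by (simp_all add: S_def)
  define x where "x n = \<sigma> n (S n)" for n
  have x: "\<bar>x n\<bar> = 1" for n
    by (simp add: x_def \<sigma>_def opp s)
  \<comment> \<open>Both coordinates at once: \<open>P\<close> is the index set that steers \<open>F\<close>, \<open>Q\<close> the one that disturbs it.\<close>
  have steer: "(\<lambda>n. F (S n - z)) \<longlonglongrightarrow> 0"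
    if F: "bounded_linear F" and "P \<inter> Q = {}" and PQ: "P \<union> Q = A \<union> B"
      and P: "\<not> summable (\<lambda>n. if n \<in> P then \<bar>F (c n)\<bar> else 0)"
      and Q: "summable (\<lambda>n. if n \<in> Q then \<bar>F (c n)\<bar> else 0)"
      and opposed: "\<And>n. n \<in> P \<Longrightarrow> x n * F (c n) * F (S n - z) \<le> 0"
    for F :: "complex \<Rightarrow> real" and P Q
  proof -
    interpret F: bounded_linear F by (fact F)
    let ?e = "\<lambda>n. if n \<in> P then x n * F (c n) else 0"
    let ?q = "\<lambda>n. if n \<in> Q then x n * F (c n) else 0"
    let ?p = "\<lambda>n. ?q n + F (s n *\<^sub>R d n)"
    show ?thesis
    proof (rule steering_tendsto_zero[of _ ?p ?e])
      fix n
      have "F (S (Suc n) - z) = F (S n - z) + x n * F (c n)"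
        unfolding S x_def by (simp add: F.add F.diff F.scaleR)
      moreover have "x n * F (c n) = ?p n + ?e n"
      proof (cases "n \<in> A \<union> B")
        case True
        then show ?thesis
          using \<open>P \<inter> Q = {}\<close> PQ by (auto simp: d_def F.zero)
      next
        case False
        then show ?thesis
          using PQ by (auto simp: d_def x_def \<sigma>_def F.scaleR)
      qed
      ultimately show "F (S (Suc n) - z) = F (S n - z) + ?p n + ?e n"
        by simp
      show "?e n * F (S n - z) \<le> 0"
        using opposed by simp
    next
      have "summable ?q"
        by (rule summable_comparison_test'[OF Q]) (simp add: abs_mult x)
      then show "summable ?p"
        by (intro summable_add F.summable sd)
      have "(\<lambda>n. F (c n)) \<longlonglongrightarrow> 0"
        using F.tendsto[OF c] by (simp add: F.zero)
      then show "?e \<longlonglongrightarrow> 0"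
        by (rule Lim_null_comparison[rotated, OF tendsto_norm_zero]) (simp add: abs_mult x)
      have "(\<lambda>n. \<bar>?e n\<bar>) = (\<lambda>n. if n \<in> P then \<bar>F (c n)\<bar> else 0)"
        by (auto simp: abs_mult x)
      then show "\<not> summable (\<lambda>n. \<bar>?e n\<bar>)"
        using P by simp
    qed
  qed
  have "(\<lambda>n. g (S n - z)) \<longlonglongrightarrow> 0"
    by (rule steer[OF g disj _ A(2) B(1)]) (auto simp: x_def \<sigma>_def opp)
  moreover have "(\<lambda>n. f (S n - z)) \<longlonglongrightarrow> 0"
    by (rule steer[OF f _ _ B(2) A(1)]) (use disj in \<open>auto simp: x_def \<sigma>_def opp\<close>)
  ultimately have "(\<lambda>n. K * (\<bar>f (S n - z)\<bar> + \<bar>g (S n - z)\<bar>)) \<longlonglongrightarrow> K * (\<bar>0\<bar> + \<bar>0\<bar>)"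
    by (intro tendsto_intros)
  then have "(\<lambda>n. K * (\<bar>f (S n - z)\<bar> + \<bar>g (S n - z)\<bar>)) \<longlonglongrightarrow> 0"
    by simp
  then have "(\<lambda>n. S n - z) \<longlonglongrightarrow> 0"
    by (rule Lim_null_comparison[rotated]) (simp add: K)
  then have "S \<longlonglongrightarrow> z"
    by (simp add: LIM_zero_iff)
  moreover have "(\<Sum>i<n. complex_of_real (x i) * c i) = S n" for n
    by (induction n) (simp_all add: S x_def scaleR_conv_of_real)
  ultimately have "(\<lambda>n. complex_of_real (x n) * c n) sums z"
    by (simp add: sums_def)
  moreover have "complex_of_real (x n) \<in> {-1, 1}" for n
    using x[of n] by (auto simp: abs_if split: if_splits)
  ultimately show ?thesis
    unfolding signed_sums_def by (intro CollectI exI[of _ "\<lambda>n. complex_of_real (x n)"]) simp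
qed

section \<open>Ratios\<close>

text \<open>
  The kernel is the real line spanned by the nonzero numbers whose quotient of real and imaginary part is the
  given ratio.
\<close>

fun ratio_form :: "real option \<Rightarrow> complex \<Rightarrow> real" where
  "ratio_form None z = Im z"
| "ratio_form (Some t) z = Re z - t * Im z"

lemma bounded_linear_ratio_form: "bounded_linear (ratio_form t)"
proof (cases t)
  case None
  then have "ratio_form t = Im"
    by (intro ext) simp
  then show ?thesis
    using bounded_linear_Im by simp
next
  case (Some q)
  then have "ratio_form t = (\<lambda>z. Re z - q * Im z)"
    by (intro ext) simp
  moreover have "bounded_linear (\<lambda>z. Re z - q * Im z)"
    by (intro bounded_linear_sub bounded_linear_const_mult bounded_linear_Re bounded_linear_Im)
  ultimately show ?thesis
    by simp
qed

lemma norm_le_ratio_forms: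
  assumes "s \<noteq> t"
  obtains K where "K > 0" "\<And>z. norm z \<le> K * (\<bar>ratio_form s z\<bar> + \<bar>ratio_form t z\<bar>)"
proof -
  define h where "h z = Complex (ratio_form s z) (ratio_form t z)" for z
  interpret s: bounded_linear "ratio_form s" by (rule bounded_linear_ratio_form)
  interpret t: bounded_linear "ratio_form t" by (rule bounded_linear_ratio_form)
  have lin: "linear h"
    by (rule linearI) (simp_all add: h_def complex_eq_iff s.add t.add s.scaleR t.scaleR)
  have "z = 0" if "h z = 0" for z
    using assms that by (cases s; cases t) (auto simp: h_def complex_eq_iff)
  then have "inj h"
    using lin by (simp add: linear_injective_0)
  then obtain b where b: "b > 0" "\<And>z. b * norm z \<le> norm (h z)"
    using linear_inj_bounded_below_pos[OF lin] by blast
  have "norm z \<le> inverse b * (\<bar>ratio_form s z\<bar> + \<bar>ratio_form t z\<bar>)" for z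
    using b(1) b(2)[of z] cmod_le[of "h z"] by (simp add: h_def field_simps)
  then show ?thesis
    using that[of "inverse b"] b(1) by simp
qed

text \<open>
  All that is used about a ratio. In contrast to the definition, this speaks about a set of indices
  and not about a subsequence, and it holds for every tolerance,
  so the tolerance can shrink while the set is thinned.
\<close>

lemma not_summable_near_ratio:
  assumes "is_ratio c t" "\<epsilon> > 0"
  shows "\<not> summable (\<lambda>n. if \<bar>ratio_form t (c n)\<bar> \<le> \<epsilon> * norm (c n) then norm (c n) else 0)"
    (is "\<not> summable ?F")
proof
  assume F: "summable ?F"
  obtain r where r: "strict_mono r" "\<not> summable (\<lambda>k. norm (c (r k)))"
    and lim: "limitin (Alexandroff_compactification euclidean) (\<lambda>k. re_im_quotient (c (r k))) t sequentially"
    using assms(1) unfolding is_ratio_def by blast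
  have "\<forall>\<^sub>F k in sequentially. \<bar>ratio_form t (c (r k))\<bar> \<le> \<epsilon> * norm (c (r k))"
  proof (cases t)
    case None
    then have "\<forall>\<^sub>F k in sequentially. Im (c (r k)) = 0 \<or> \<bar>Re (c (r k)) / Im (c (r k))\<bar> > 1 / \<epsilon>"
      using lim by (simp only: limitin_re_im_quotient_None)
    then show ?thesis
    proof (rule eventually_mono)
      fix k assume k: "Im (c (r k)) = 0 \<or> \<bar>Re (c (r k)) / Im (c (r k))\<bar> > 1 / \<epsilon>"
      have "\<bar>Im (c (r k))\<bar> \<le> \<epsilon> * \<bar>Re (c (r k))\<bar>"
        using k \<open>\<epsilon> > 0\<close> by (cases "Im (c (r k)) = 0") (auto simp: field_simps)
      also have "\<dots> \<le> \<epsilon> * norm (c (r k))"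
        using \<open>\<epsilon> > 0\<close> abs_Re_le_cmod by simp
      finally show "\<bar>ratio_form t (c (r k))\<bar> \<le> \<epsilon> * norm (c (r k))"
        by (simp add: None)
    qed
  next
    case (Some q)
    then have "\<forall>\<^sub>F k in sequentially. Im (c (r k)) \<noteq> 0"
      "(\<lambda>k. Re (c (r k)) / Im (c (r k))) \<longlonglongrightarrow> q"
      using lim by (simp_all only: limitin_re_im_quotient_Some)
    then have "\<forall>\<^sub>F k in sequentially. Im (c (r k)) \<noteq> 0 \<and> \<bar>Re (c (r k)) / Im (c (r k)) - q\<bar> < \<epsilon>"
      using \<open>\<epsilon> > 0\<close> by (auto simp: eventually_conj_iff tendsto_iff dist_real_def)
    then show ?thesis
    proof (rule eventually_mono)
      fix k assume k: "Im (c (r k)) \<noteq> 0 \<and> \<bar>Re (c (r k)) / Im (c (r k)) - q\<bar> < \<epsilon>"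
      have "\<bar>Re (c (r k)) - q * Im (c (r k))\<bar>
          = \<bar>Re (c (r k)) / Im (c (r k)) - q\<bar> * \<bar>Im (c (r k))\<bar>"
        using k by (simp add: abs_mult[symmetric] field_simps)
      also have "\<dots> \<le> \<epsilon> * norm (c (r k))"
        using k abs_Im_le_cmod \<open>\<epsilon> > 0\<close> by (intro mult_mono) auto
      finally show "\<bar>ratio_form t (c (r k))\<bar> \<le> \<epsilon> * norm (c (r k))"
        by (simp add: Some)
    qed
  qed
  then have "\<forall>\<^sub>F k in sequentially. ?F (r k) = norm (c (r k))"
    by (rule eventually_mono) simp
  moreover have "summable (\<lambda>k. ?F (r k))"
    using summable_reindex[OF F strict_mono_imp_inj_on[OF r(1)]] by (simp add: o_def)
  ultimately show False
    using r(2) summable_cong[of "\<lambda>k. ?F (r k)" "\<lambda>k. norm (c (r k))"] by simp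
qed

lemma thin_along_ratio:
  assumes "c \<longlonglongrightarrow> 0" "is_ratio c t" "\<epsilon> > 0"
    and K: "\<And>z. norm z \<le> K * (\<bar>ratio_form t z\<bar> + \<bar>f z\<bar>)"
  obtains A where "\<And>n. n \<in> A \<Longrightarrow> \<bar>ratio_form t (c n)\<bar> \<le> \<epsilon> * norm (c n)"
    "summable (\<lambda>n. if n \<in> A then \<bar>ratio_form t (c n)\<bar> else 0)"
    "\<not> summable (\<lambda>n. if n \<in> A then \<bar>f (c n)\<bar> else 0)"
proof -
  obtain W where W: "\<And>n. norm (c n) \<le> W"
    using convergent_imp_Bseq[OF convergentI[OF assms(1)]] by (auto simp: Bseq_def)
  obtain A where A: "\<And>n. n \<in> A \<Longrightarrow> \<bar>ratio_form t (c n)\<bar> \<le> \<epsilon> * norm (c n)"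
    "summable (\<lambda>n. if n \<in> A then \<bar>ratio_form t (c n)\<bar> else 0)"
    "\<not> summable (\<lambda>n. if n \<in> A then norm (c n) else 0)"
    using thin_to_summable[of "\<lambda>n. \<bar>ratio_form t (c n)\<bar>" "\<lambda>n. norm (c n)" W \<epsilon>]
      not_summable_near_ratio[OF assms(2)] W assms(3) by auto
  have "\<not> summable (\<lambda>n. if n \<in> A then \<bar>f (c n)\<bar> else 0)"
  proof
    assume "summable (\<lambda>n. if n \<in> A then \<bar>f (c n)\<bar> else 0)"
    then have "summable (\<lambda>n. K * ((if n \<in> A then \<bar>ratio_form t (c n)\<bar> else 0) + (if n \<in> A then \<bar>f (c n)\<bar> else 0)))"
      by (intro summable_mult summable_add A(2))
    then have "summable (\<lambda>n. if n \<in> A then norm (c n) else 0)"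
      by (rule summable_comparison_test') (auto simp: K)
    then show False
      using A(3) by simp
  qed
  then show ?thesis
    using that[of A] A(1,2) by blast
qed

theorem theorem1p3:
  fixes c :: "nat \<Rightarrow> complex"
  assumes "c \<longlonglongrightarrow> 0"
    and "\<not> summable (\<lambda>n. norm (c n))"
    and "\<exists>t1 t2. t1 \<noteq> t2 \<and> is_ratio c t1 \<and> is_ratio c t2"
  shows "signed_sums c = UNIV"
proof -
  obtain t1 t2 where t: "t1 \<noteq> t2" "is_ratio c t1" "is_ratio c t2"
    using assms(3) by blast
  let ?f = "ratio_form t1" and ?g = "ratio_form t2"
  obtain K where K: "K > 0" "\<And>z. norm z \<le> K * (\<bar>?f z\<bar> + \<bar>?g z\<bar>)"
    using norm_le_ratio_forms[OF t(1)] by metis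
  then have K': "\<And>z. norm z \<le> K * (\<bar>?g z\<bar> + \<bar>?f z\<bar>)"
    by (simp add: add.commute)
  \<comment> \<open>So small that a nonzero number cannot be near both directions, which makes the two index sets
    disjoint up to vanishing terms.\<close>
  define \<epsilon> where "\<epsilon> = 1 / (4 * K)"
  have \<epsilon>: "\<epsilon> > 0"
    using K(1) by (simp add: \<epsilon>_def)
  obtain A where A: "\<And>n. n \<in> A \<Longrightarrow> \<bar>?f (c n)\<bar> \<le> \<epsilon> * norm (c n)"
    "summable (\<lambda>n. if n \<in> A then \<bar>?f (c n)\<bar> else 0)"
    "\<not> summable (\<lambda>n. if n \<in> A then \<bar>?g (c n)\<bar> else 0)"
    using thin_along_ratio[OF assms(1) t(2) \<epsilon> K(2)] by blast
  obtain B where B: "\<And>n. n \<in> B \<Longrightarrow> \<bar>?g (c n)\<bar> \<le> \<epsilon> * norm (c n)"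
    "summable (\<lambda>n. if n \<in> B then \<bar>?g (c n)\<bar> else 0)"
    "\<not> summable (\<lambda>n. if n \<in> B then \<bar>?f (c n)\<bar> else 0)"
    using thin_along_ratio[OF assms(1) t(3) \<epsilon> K'] by blast
  have zero: "c n = 0" if "n \<in> A" "n \<in> B" for n
  proof -
    have "norm (c n) \<le> K * (\<bar>?f (c n)\<bar> + \<bar>?g (c n)\<bar>)"
      by (rule K)
    also have "\<dots> \<le> K * (\<epsilon> * norm (c n) + \<epsilon> * norm (c n))"
      using A(1)[OF that(1)] B(1)[OF that(2)] K(1) by simp
    also have "\<dots> = norm (c n) / 2"
      using K(1) by (simp add: \<epsilon>_def)
    finally show ?thesis
      by simp
  qed
  have B': "(\<lambda>n. if n \<in> B - A then \<bar>ratio_form q (c n)\<bar> else 0)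
      = (\<lambda>n. if n \<in> B then \<bar>ratio_form q (c n)\<bar> else 0)" for q
  proof (rule ext)
    fix n
    have "ratio_form q (c n) = 0" if "n \<in> A" "n \<in> B"
      using zero[OF that] by (cases q) simp_all
    then show "(if n \<in> B - A then \<bar>ratio_form q (c n)\<bar> else 0)
        = (if n \<in> B then \<bar>ratio_form q (c n)\<bar> else 0)"
      by auto
  qed
  have "z \<in> signed_sums c" for z
    by (rule signed_sum_by_steering[OF assms(1) bounded_linear_ratio_form bounded_linear_ratio_form
          K(2) _ A(2,3) B(2,3)[folded B']]) blast
  then show ?thesis
    by blast
qed

end
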